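(* Let $M$ be a Hermitian positive-definite matrix of order $n$, and for $1\le i\le n$ let $M_i$ be the leading principal submatrix of order $i$ of $M$. For each $1\le i\le n$ let $S_i$ be a principal submatrix of $M_i$ that includes row $i$ and column $i$ of $M_i$, and let $\sigma_i$ be the trailing (last) diagonal element of $S_i^{-1}$. Suppose that for some $1<j\leq n$, $\hat S_j$ is a principal submatrix of $S_j$ that also includes row $j$ and column $j$ of $M_j$, and let $\hat\sigma_j$ be the trailing diagonal element of $\hat S_j^{-1}$. Then $$\det(M)\leq \prod_{i=1}^n\frac{1}{\sigma_i}\leq \frac{1}{\hat\sigma_j}\prod_{i=1,\,i\neq j}^n\frac{1}{\sigma_i}.$$
   Context: A principal submatrix of a matrix is obtained by keeping the rows and columns indexed by the same nonempty index set, in their original order. Since $S_i$ contains index $i$, the largest index of $M_i$, the last row and column of $S_i$ correspond to row and column $i$ of $M$; the same holds for $\hat S_j$ with index $j$. The quantity $\prod_{i=1}^n 1/\sigma_i$ is called a sparse inverse approximation of $\det(M)$. *)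

theory Defs
  imports
    "Jordan_Normal_Form.Schur_Decomposition"
    "Jordan_Normal_Form.DL_Submatrix"
begin

(* Matrix rows and columns are numbered from 0, so "row i" of the usual 1-based
   numbering is row i - 1 here, and a principal submatrix is given by a set of 0-based
   indices.  pick I k is the k-th element of I in increasing order, i.e. the row of A that
   becomes row k of principal_submatrix A I.  The order on complex numbers is that of HOL-Library.Complex_Order:
   x \<le> y means Re x \<le> Re y and Im x = Im y. *)

definition hermitian_mat :: "complex mat \<Rightarrow> bool" where
  "hermitian_mat A \<longleftrightarrow> square_mat A \<and> mat_adjoint A = A"

(* (A *\<^sub>v v) \<bullet>c v is v^* A v; being > 0 in the order on complex numbers includes being real. *)
definition positive_definite_mat :: "complex mat \<Rightarrow> bool" where
  "positive_definite_mat A \<longleftrightarrow> square_mat A \<and>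
     (\<forall>v \<in> carrier_vec (dim_row A). v \<noteq> 0\<^sub>v (dim_row A) \<longrightarrow> 0 < (A *\<^sub>v v) \<bullet>c v)"

definition principal_submatrix :: "'a mat \<Rightarrow> nat set \<Rightarrow> 'a mat" where
  "principal_submatrix A I = submatrix A I I"

definition leading_principal_submatrix :: "'a mat \<Rightarrow> nat \<Rightarrow> 'a mat" where
  "leading_principal_submatrix A i = principal_submatrix A {..<i}"

definition trailing_diag :: "'a mat \<Rightarrow> 'a" where
  "trailing_diag A = A $$ (dim_row A - 1, dim_col A - 1)"

(* mat_inverse returns None exactly for non-invertible matrices; the value below is
   unspecified for those. *)
definition inverse_mat :: "'a :: field mat \<Rightarrow> 'a mat" where
  "inverse_mat A = the (mat_inverse A)"

end

theory Submission
  imports Defs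
begin

(* For a Hermitian positive-definite A, the reciprocal of the trailing diagonal element of its
   inverse is the minimum of the form of A over the vectors with last component 1.  Passing to a
   principal submatrix that keeps the last row and column restricts this minimum to vectors
   supported on fewer coordinates, so it can only grow.  By Cramer's rule, for the leading
   principal submatrices the minima are the ratios of consecutive leading minors, and their
   product telescopes to det M. *)

section \<open>Hermitian positive-definite matrices and their inverses\<close>

definition hpd_mat :: "nat \<Rightarrow> complex mat \<Rightarrow> bool" where
  "hpd_mat n A \<longleftrightarrow> A \<in> carrier_mat n n \<and> hermitian_mat A \<and> positive_definite_mat A"

lemma hermitian_mat_iff:
  assumes "A \<in> carrier_mat n n"
  shows "hermitian_mat A \<longleftrightarrow> (\<forall>i<n. \<forall>k<n. A $$ (i, k) = cnj (A $$ (k, i)))"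
proof -
  have [simp]: "dim_row A = n" "dim_col A = n" using assms by auto
  have "mat_adjoint A = mat n n (\<lambda>(i, k). cnj (A $$ (k, i)))"
    by (rule eq_matI) (auto simp: mat_adjoint_def mat_of_rows_index)
  moreover have "mat n n (\<lambda>(i, k). cnj (A $$ (k, i))) = A
      \<longleftrightarrow> (\<forall>i<n. \<forall>k<n. A $$ (i, k) = cnj (A $$ (k, i)))" (is "?B = A \<longleftrightarrow> ?R")
  proof
    assume "?B = A"
    then have *: "A $$ (i, k) = ?B $$ (i, k)" for i k by simp
    show ?R
    proof (intro allI impI)
      fix i k assume "i < n" "k < n"
      then show "A $$ (i, k) = cnj (A $$ (k, i))" by (subst *) simp
    qed
  next
    assume R: ?R
    show "?B = A"
    proof (rule eq_matI)
      fix i k assume "i < dim_row A" "k < dim_col A"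
      then show "?B $$ (i, k) = A $$ (i, k)" using R[rule_format, of i k] by simp
    qed auto
  qed
  ultimately show ?thesis by (simp add: hermitian_mat_def square_mat.simps)
qed

text \<open>Expanding both sides into double sums, interchanging the summations matches them up by
  the symmetry of the entries. This supplies the second cross term when the form is expanded at a
  difference of two vectors.\<close>

lemma hermitian_form_swap:
  assumes A: "A \<in> carrier_mat n n" and h: "hermitian_mat A"
    and v: "v \<in> carrier_vec n" and w: "w \<in> carrier_vec n"
  shows "(A *\<^sub>v v) \<bullet>c w = cnj ((A *\<^sub>v w) \<bullet>c v)"
proof -
  have form: "(A *\<^sub>v v) \<bullet>c w = (\<Sum>i<n. \<Sum>k<n. A $$ (i, k) * v $ k * cnj (w $ i))"
    if "v \<in> carrier_vec n" "w \<in> carrier_vec n" for v w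
    using A that by (auto simp: scalar_prod_def sum_distrib_right atLeast0LessThan intro!: sum.cong)
  have "cnj ((A *\<^sub>v w) \<bullet>c v) = (\<Sum>i<n. \<Sum>k<n. cnj (A $$ (i, k)) * cnj (w $ k) * v $ i)"
    by (simp add: form[OF w v])
  also have "\<dots> = (\<Sum>k<n. \<Sum>i<n. cnj (A $$ (i, k)) * cnj (w $ k) * v $ i)"
    by (rule sum.swap)
  also have "\<dots> = (\<Sum>k<n. \<Sum>i<n. A $$ (k, i) * v $ i * cnj (w $ k))"
  proof (intro sum.cong refl)
    fix k i assume "k \<in> {..<n}" "i \<in> {..<n}"
    then have "A $$ (k, i) = cnj (A $$ (i, k))" using h hermitian_mat_iff[OF A] by blast
    then show "cnj (A $$ (i, k)) * cnj (w $ k) * v $ i = A $$ (k, i) * v $ i * cnj (w $ k)"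
      by (simp add: mult_ac)
  qed
  finally show ?thesis by (simp add: form[OF v w])
qed

lemma hpd_mat_form_nonneg:
  assumes "hpd_mat n A" "v \<in> carrier_vec n"
  shows "0 \<le> (A *\<^sub>v v) \<bullet>c v"
  using assms by (cases "v = 0\<^sub>v n") (auto simp: hpd_mat_def positive_definite_mat_def less_imp_le)

text \<open>A nonzero kernel vector would make the form vanish, so \<open>det A\<close> is nonzero
  and \<open>inverse_mat\<close> is a genuine inverse instead of the unspecified value.\<close>

lemma hpd_mat_inverse:
  assumes "hpd_mat n A"
  shows "inverse_mat A \<in> carrier_mat n n" "A * inverse_mat A = 1\<^sub>m n"
proof -
  have A: "A \<in> carrier_mat n n" using assms by (simp add: hpd_mat_def)
  have "det A \<noteq> 0"
  proof
    assume "det A = 0"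
    then obtain v where v: "v \<in> carrier_vec n" "v \<noteq> 0\<^sub>v n" "A *\<^sub>v v = 0\<^sub>v n"
      using det_0_iff_vec_prod_zero[OF A] by blast
    then have "0 < 0\<^sub>v n \<bullet>c v"
      using assms by (metis carrier_matD(1) hpd_mat_def positive_definite_mat_def)
    then show False using v by simp
  qed
  then have "A \<in> Units (ring_mat TYPE(complex) n ())"
    by (rule det_non_zero_imp_unit[OF A])
  then obtain B where "mat_inverse A = Some B"
    using mat_inverse(1)[OF A, of "()"] by (cases "mat_inverse A") auto
  then show "inverse_mat A \<in> carrier_mat n n" "A * inverse_mat A = 1\<^sub>m n"
    using mat_inverse(2)[OF A] by (auto simp: inverse_mat_def)
qed

text \<open>The witness is the last column of the inverse. Its last entry is, up to conjugation, the
  value of the form at that column, hence positive.\<close>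

lemma trailing_diag_inverse:
  assumes h: "hpd_mat n A" and n: "0 < n"
  obtains x where "x \<in> carrier_vec n" "A *\<^sub>v x = unit_vec n (n - 1)"
    "x $ (n - 1) = trailing_diag (inverse_mat A)" "0 < trailing_diag (inverse_mat A)"
proof -
  note inv = hpd_mat_inverse[OF h]
  have A: "A \<in> carrier_mat n n" using h by (simp add: hpd_mat_def)
  define x where "x = inverse_mat A *\<^sub>v unit_vec n (n - 1)"
  have x: "x \<in> carrier_vec n" using inv(1) by (simp add: x_def)
  have Ax: "A *\<^sub>v x = unit_vec n (n - 1)"
    using assoc_mult_mat_vec[OF A inv(1), of "unit_vec n (n - 1)"] inv(2) by (simp add: x_def)
  have last: "x $ (n - 1) = trailing_diag (inverse_mat A)"
    using inv(1) n by (simp add: x_def trailing_diag_def)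
  have "x \<noteq> 0\<^sub>v n"
  proof
    assume "x = 0\<^sub>v n"
    then have "A *\<^sub>v x = 0\<^sub>v n" using A by auto
    then show False using Ax n unit_vec_nonzero[of "n - 1" n, where 'a = complex] by simp
  qed
  then have "0 < (A *\<^sub>v x) \<bullet>c x"
    using h x A by (auto simp: hpd_mat_def positive_definite_mat_def)
  also have "(A *\<^sub>v x) \<bullet>c x = cnj (x $ (n - 1))"
    using x n by (simp add: Ax scalar_prod_left_unit[of _ n])
  finally have "0 < trailing_diag (inverse_mat A)"
    unfolding last[symmetric] by (simp add: less_complex_def)
  with x Ax last that show thesis by blast
qed

section \<open>Principal submatrices and extension of vectors by zero\<close>

lemma principal_submatrix_carrier:
  assumes "A \<in> carrier_mat n n" "K \<subseteq> {..<n}"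
  shows "principal_submatrix A K \<in> carrier_mat (card K) (card K)"
proof -
  have "{i. i < n \<and> i \<in> K} = K" using assms by auto
  then show ?thesis using assms by (auto simp: principal_submatrix_def dim_submatrix)
qed

lemma principal_submatrix_index:
  assumes "A \<in> carrier_mat n n" "K \<subseteq> {..<n}" "i < card K" "k < card K"
  shows "principal_submatrix A K $$ (i, k) = A $$ (pick K i, pick K k)"
proof -
  have "{i. i < n \<and> i \<in> K} = K" using assms by auto
  then show ?thesis using assms by (auto simp: principal_submatrix_def intro!: submatrix_index)
qed

text \<open>Extension by zero from the coordinates in \<open>K\<close> to all \<open>n\<close>
  coordinates. The cardinality is the position of \<open>k\<close> within \<open>K\<close>, so it
  inverts \<open>pick K\<close>.\<close>

definition embed_vec :: "nat \<Rightarrow> nat set \<Rightarrow> 'a :: zero vec \<Rightarrow> 'a vec" where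
  "embed_vec n K u = vec n (\<lambda>k. if k \<in> K then u $ card {a \<in> K. a < k} else 0)"

lemma embed_vec_carrier [simp]: "embed_vec n K u \<in> carrier_vec n"
  by (simp add: embed_vec_def)

lemma embed_vec_pick:
  assumes "K \<subseteq> {..<n}" "i < card K"
  shows "embed_vec n K u $ pick K i = u $ i"
  using assms pick_in_set_le[of i K] card_pick_le[of i K] by (auto simp: embed_vec_def)

lemma bij_betw_pick:
  assumes "finite K"
  shows "bij_betw (pick K) {..<card K} K"
proof -
  have inj: "inj_on (pick K) {..<card K}"
    by (rule inj_onI) (metis card_pick_le lessThan_iff)
  moreover have "pick K ` {..<card K} \<subseteq> K" using pick_in_set_le by auto
  ultimately show ?thesis
    using assms by (simp add: bij_betw_def card_image card_subset_eq)
qed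

text \<open>Coordinates outside \<open>K\<close> contribute nothing because \<open>g 0 = 0\<close>,
  and \<open>pick K\<close> reindexes the rest. The function \<open>g\<close> is there to cover both
  the matrix-vector product, with \<open>id\<close>, and the form, with \<open>cnj\<close>.\<close>

lemma sum_embed_vec:
  fixes f :: "nat \<Rightarrow> complex" and g :: "complex \<Rightarrow> complex"
  assumes "K \<subseteq> {..<n}" and g: "g 0 = 0"
  shows "(\<Sum>k<n. f k * g (embed_vec n K u $ k)) = (\<Sum>i<card K. f (pick K i) * g (u $ i))"
proof -
  have fin: "finite K" using assms(1) finite_subset by blast
  have "(\<Sum>k<n. f k * g (embed_vec n K u $ k)) = (\<Sum>k\<in>K. f k * g (embed_vec n K u $ k))"
    using assms by (intro sum.mono_neutral_right) (auto simp: embed_vec_def)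
  also have "\<dots> = (\<Sum>i<card K. f (pick K i) * g (embed_vec n K u $ pick K i))"
    by (rule sum.reindex_bij_betw[OF bij_betw_pick[OF fin], symmetric])
  finally show ?thesis by (simp add: embed_vec_pick[OF assms(1)])
qed

lemma mult_embed_vec:
  fixes A :: "complex mat"
  assumes A: "A \<in> carrier_mat n n" and K: "K \<subseteq> {..<n}"
    and u: "u \<in> carrier_vec (card K)" and i: "i < card K"
  shows "(A *\<^sub>v embed_vec n K u) $ pick K i = (principal_submatrix A K *\<^sub>v u) $ i"
proof -
  have p: "pick K i < n" using pick_in_set_le[OF i] K by auto
  have "(A *\<^sub>v embed_vec n K u) $ pick K i = (\<Sum>k<n. A $$ (pick K i, k) * id (embed_vec n K u $ k))"
    using A p by (simp add: scalar_prod_def embed_vec_def atLeast0LessThan cong: if_cong)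
  also have "\<dots> = (\<Sum>k<card K. A $$ (pick K i, pick K k) * id (u $ k))"
    by (rule sum_embed_vec[OF K]) simp
  also have "\<dots> = (principal_submatrix A K *\<^sub>v u) $ i"
    using principal_submatrix_carrier[OF A K] u i
    by (auto simp: scalar_prod_def atLeast0LessThan principal_submatrix_index[OF A K])
  finally show ?thesis .
qed

text \<open>This identifies the form of a principal submatrix with the restriction of the form of
  \<open>A\<close> to the vectors supported on \<open>K\<close>.\<close>

lemma form_embed_vec:
  fixes A :: "complex mat"
  assumes A: "A \<in> carrier_mat n n" and K: "K \<subseteq> {..<n}"
    and u: "u \<in> carrier_vec (card K)"
  shows "(A *\<^sub>v embed_vec n K u) \<bullet>c embed_vec n K u = (principal_submatrix A K *\<^sub>v u) \<bullet>c u"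
proof -
  have "(A *\<^sub>v embed_vec n K u) \<bullet>c embed_vec n K u
      = (\<Sum>k<n. (A *\<^sub>v embed_vec n K u) $ k * cnj (embed_vec n K u $ k))"
    by (simp add: scalar_prod_def[of _ "conjugate _"] carrier_vecD[OF embed_vec_carrier]
        atLeast0LessThan)
  also have "\<dots> = (\<Sum>i<card K. (A *\<^sub>v embed_vec n K u) $ pick K i * cnj (u $ i))"
    by (rule sum_embed_vec[OF K]) simp
  also have "\<dots> = (\<Sum>i<card K. (principal_submatrix A K *\<^sub>v u) $ i * cnj (u $ i))"
    using mult_embed_vec[OF A K u] by simp
  also have "\<dots> = (principal_submatrix A K *\<^sub>v u) \<bullet>c u"
    using u by (simp add: scalar_prod_def[of _ "conjugate _"] atLeast0LessThan)
  finally show ?thesis .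
qed

text \<open>Definiteness is inherited because extension by zero preserves the form and sends nonzero
  vectors to nonzero vectors.\<close>

lemma hpd_mat_principal_submatrix:
  assumes h: "hpd_mat n A" and K: "K \<subseteq> {..<n}"
  shows "hpd_mat (card K) (principal_submatrix A K)"
proof -
  let ?B = "principal_submatrix A K"
  have A: "A \<in> carrier_mat n n" using h by (simp add: hpd_mat_def)
  note B = principal_submatrix_carrier[OF A K]
  have pick: "pick K i < n" if "i < card K" for i
    using pick_in_set_le[OF that] K by auto
  have "hermitian_mat ?B"
    unfolding hermitian_mat_iff[OF B]
  proof (intro allI impI)
    fix i k assume ik: "i < card K" "k < card K"
    have "A $$ (pick K i, pick K k) = cnj (A $$ (pick K k, pick K i))"
      using h pick ik hermitian_mat_iff[OF A] unfolding hpd_mat_def by blast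
    then show "?B $$ (i, k) = cnj (?B $$ (k, i))"
      using ik by (simp add: principal_submatrix_index[OF A K])
  qed
  moreover have "positive_definite_mat ?B"
    unfolding positive_definite_mat_def
  proof (intro conjI ballI impI)
    show "square_mat ?B" using B by (simp add: square_mat.simps)
    fix u :: "complex vec" assume "u \<in> carrier_vec (dim_row ?B)" and nz: "u \<noteq> 0\<^sub>v (dim_row ?B)"
    then have u: "u \<in> carrier_vec (card K)" using B by simp
    have "embed_vec n K u \<noteq> 0\<^sub>v n"
    proof
      assume 0: "embed_vec n K u = 0\<^sub>v n"
      have "u $ i = 0" if "i < card K" for i
        using embed_vec_pick[OF K that, of u] 0 pick[OF that] by simp
      then have "u = 0\<^sub>v (dim_row ?B)" using u B by (intro eq_vecI) auto
      with nz show False ..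
    qed
    then have "0 < (A *\<^sub>v embed_vec n K u) \<bullet>c embed_vec n K u"
      using h A by (auto simp: hpd_mat_def positive_definite_mat_def)
    then show "0 < (?B *\<^sub>v u) \<bullet>c u" by (simp add: form_embed_vec[OF A K u])
  qed
  ultimately show ?thesis using B by (simp add: hpd_mat_def)
qed

section \<open>Monotonicity of the trailing diagonal element of the inverse\<close>

lemma pick_last:
  assumes K: "K \<subseteq> {..<n}" and last: "n - 1 \<in> K"
  shows "pick K (card K - 1) = n - 1" "0 < card K"
proof -
  have fin: "finite K" using K finite_subset by blast
  \<comment> \<open>As the largest element of \<open>K\<close>, \<open>n - 1\<close> has all the
    others below it, so its 0-based position is \<open>card K - 1\<close>.\<close>
  have "{a \<in> K. a < n - 1} = K - {n - 1}" using K by fastforce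
  then have "card {a \<in> K. a < n - 1} = card K - 1" using last fin by simp
  then show "pick K (card K - 1) = n - 1" using pick_card_in_set[OF last] by simp
  show "0 < card K" using last fin card_gt_0_iff by blast
qed

text \<open>Let \<open>y\<close> be the last column of the inverse of \<open>A\<close>, and
  \<open>w\<close> the zero extension of the last column of the inverse of the submatrix. The form
  at \<open>y - w\<close> is exactly \<open>?t - ?s\<close>, so its nonnegativity is the claim. The
  vectors are not scaled to last component 1; their last components are \<open>?t\<close> and
  \<open>?s\<close>.\<close>

lemma trailing_diag_inverse_submatrix_le:
  assumes h: "hpd_mat n A" and K: "K \<subseteq> {..<n}" and last: "n - 1 \<in> K"
  shows "trailing_diag (inverse_mat (principal_submatrix A K)) \<le> trailing_diag (inverse_mat A)"
    (is "?s \<le> ?t")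
proof -
  let ?B = "principal_submatrix A K" and ?e = "unit_vec n (n - 1) :: complex vec"
  have n: "0 < n" using K last by auto
  have A: "A \<in> carrier_mat n n" and herm: "hermitian_mat A" using h by (auto simp: hpd_mat_def)
  note c = pick_last[OF K last]
  obtain x where x: "x \<in> carrier_vec (card K)" "?B *\<^sub>v x = unit_vec (card K) (card K - 1)"
    "x $ (card K - 1) = ?s" and s: "0 < ?s"
    using trailing_diag_inverse[OF hpd_mat_principal_submatrix[OF h K] c(2)] by blast
  obtain y where y: "y \<in> carrier_vec n" "A *\<^sub>v y = ?e" "y $ (n - 1) = ?t" and t: "0 < ?t"
    using trailing_diag_inverse[OF h n] by blast
  define w where "w = embed_vec n K x"
  have w: "w \<in> carrier_vec n" by (simp add: w_def)
  have wl: "w $ (n - 1) = ?s"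
    using embed_vec_pick[OF K, of "card K - 1" x] c x(3) by (simp add: w_def)
  have cs: "cnj ?s = ?s" and ct: "cnj ?t = ?t"
    using s t by (auto simp: less_complex_def complex_eq_iff)
  have eq1: "(A *\<^sub>v y) \<bullet>c y = ?t" using y n by (simp add: scalar_prod_left_unit[of _ n] ct)
  \<comment> \<open>Since \<open>A *\<^sub>v y\<close> is the last unit vector, pairing with
    \<open>w\<close> reads off the last entry of \<open>w\<close>, which is real.\<close>
  have eq2: "(A *\<^sub>v y) \<bullet>c w = ?s"
    using y w n by (simp add: scalar_prod_left_unit[of _ n] wl[unfolded One_nat_def] cs)
  have eq3: "(A *\<^sub>v w) \<bullet>c y = ?s"
    using hermitian_form_swap[OF A herm w y(1)] eq2 cs by simp
  \<comment> \<open>The form at \<open>w\<close> is computed inside the submatrix, where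
    \<open>x\<close> is mapped to the last unit vector.\<close>
  have eq4: "(A *\<^sub>v w) \<bullet>c w = ?s"
    unfolding w_def form_embed_vec[OF A K x(1)] x(2)
    using x c by (simp add: scalar_prod_left_unit[of _ "card K"] cs)
  have Ay: "A *\<^sub>v y \<in> carrier_vec n" and Aw: "A *\<^sub>v w \<in> carrier_vec n"
    using mult_mat_vec_carrier[OF A] y(1) w by blast+
  have "0 \<le> (A *\<^sub>v (y - w)) \<bullet>c (y - w)"
    using y w by (intro hpd_mat_form_nonneg[OF h]) auto
  also have "A *\<^sub>v (y - w) = A *\<^sub>v y - A *\<^sub>v w"
    using A y w by (simp add: mult_minus_distrib_mat_vec)
  also have "conjugate (y - w) = conjugate y - conjugate w"
    using y w by (intro eq_vecI) auto
  also have "(A *\<^sub>v y - A *\<^sub>v w) \<bullet> (conjugate y - conjugate w)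
      = ((A *\<^sub>v y) \<bullet>c y - (A *\<^sub>v y) \<bullet>c w) - ((A *\<^sub>v w) \<bullet>c y - (A *\<^sub>v w) \<bullet>c w)"
    using Ay Aw y(1) w
    by (simp add: minus_scalar_prod_distrib[of _ n] scalar_prod_minus_distrib[of _ n])
  also have "\<dots> = ?t - ?s" unfolding eq1 eq2 eq3 eq4 by simp
  finally show ?thesis by simp
qed

section \<open>Leading principal minors as telescoping products\<close>

lemma leading_principal_submatrix_eq:
  assumes "A \<in> carrier_mat n n" "i \<le> n"
  shows "leading_principal_submatrix A i = mat i i (\<lambda>(r, c). A $$ (r, c))"
proof -
  \<comment> \<open>An element \<open>k\<close> of an initial segment has exactly \<open>k\<close>
    predecessors, so \<open>pick\<close> is the identity there.\<close>
  have pick: "pick {..<i} k = k" if "k < i" for k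
    using pick_card_in_set[of k "{..<i}"] that
    by (auto simp: Collect_conj_eq lessThan_def[symmetric] Int_absorb1)
  have K: "{..<i} \<subseteq> {..<n}" using assms by auto
  show ?thesis
    using principal_submatrix_carrier[OF assms(1) K] principal_submatrix_index[OF assms(1) K]
    by (intro eq_matI) (auto simp: leading_principal_submatrix_def pick)
qed

text \<open>Cramer's rule at the last diagonal entry: the adjugate is \<open>det A\<close> times the
  inverse, and its entry there is the minor left after deleting the last row and column.\<close>

lemma det_mult_trailing_diag_inverse:
  assumes h: "hpd_mat n A" and n: "0 < n"
  shows "det A * trailing_diag (inverse_mat A) = det (leading_principal_submatrix A (n - 1))"
proof -
  let ?B = "inverse_mat A" and ?l = "n - 1"
  have A: "A \<in> carrier_mat n n" using h by (simp add: hpd_mat_def)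
  note inv = hpd_mat_inverse[OF h]
  note adj = adj_mat[OF A]
  have "adj_mat A = adj_mat A * (A * ?B)" using adj(1) inv by simp
  also have "\<dots> = (adj_mat A * A) * ?B" using assoc_mult_mat[OF adj(1) A inv(1)] by simp
  also have "\<dots> = det A \<cdot>\<^sub>m ?B" using adj(3) inv(1) mult_smult_assoc_mat[of "1\<^sub>m n" n n ?B n] by simp
  finally have "adj_mat A $$ (?l, ?l) = det A * ?B $$ (?l, ?l)" using inv(1) n by simp
  \<comment> \<open>The cofactor sign is an even power of -1.\<close>
  moreover have "adj_mat A $$ (?l, ?l) = det (mat_delete A ?l ?l)"
    using A n by (simp add: adj_mat_def cofactor_def flip: mult_2)
  moreover have "mat_delete A ?l ?l = leading_principal_submatrix A ?l"
    using A n by (subst leading_principal_submatrix_eq[OF A])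
      (auto simp: mat_delete_def intro!: eq_matI)
  ultimately show ?thesis using inv(1) by (simp add: trailing_diag_def)
qed

lemma hpd_mat_leading:
  assumes "hpd_mat n A" "i \<le> n"
  shows "hpd_mat i (leading_principal_submatrix A i)"
  using hpd_mat_principal_submatrix[OF assms(1), of "{..<i}"] assms(2)
  by (simp add: leading_principal_submatrix_def)

text \<open>By Cramer's rule each factor is a ratio of consecutive leading minors, so the product
  telescopes down to the determinant 1 of the empty matrix.\<close>

lemma det_leading_eq_prod:
  assumes h: "hpd_mat n A" and "i \<le> n"
  shows "det (leading_principal_submatrix A i)
    = (\<Prod>k=1..i. 1 / trailing_diag (inverse_mat (leading_principal_submatrix A k)))"
  using \<open>i \<le> n\<close>
proof (induction i)
  case 0
  have "A \<in> carrier_mat n n" using h by (simp add: hpd_mat_def)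
  then show ?case by (simp add: leading_principal_submatrix_eq)
next
  case (Suc i)
  let ?L = "leading_principal_submatrix A (Suc i)"
  have A: "A \<in> carrier_mat n n" using h by (simp add: hpd_mat_def)
  have hL: "hpd_mat (Suc i) ?L" using hpd_mat_leading[OF h Suc.prems] .
  \<comment> \<open>Truncating in two stages equals truncating once, so Cramer's rule for
    \<open>?L\<close> yields the previous leading minor of \<open>A\<close> itself.\<close>
  have "leading_principal_submatrix ?L i = leading_principal_submatrix A i"
    using hL Suc.prems A
    by (subst (1) leading_principal_submatrix_eq[of _ "Suc i"])
      (auto simp: hpd_mat_def leading_principal_submatrix_eq[OF A] intro!: eq_matI)
  then have "det ?L * trailing_diag (inverse_mat ?L) = det (leading_principal_submatrix A i)"
    using det_mult_trailing_diag_inverse[OF hL] by simp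
  moreover have "trailing_diag (inverse_mat ?L) \<noteq> 0"
    using trailing_diag_inverse[OF hL] by fastforce
  ultimately have "det ?L = det (leading_principal_submatrix A i) * (1 / trailing_diag (inverse_mat ?L))"
    by (simp add: field_simps)
  then show ?case using Suc by simp
qed

section \<open>Inequalities in the partial order on complex numbers\<close>

lemma complex_inverse_antimono:
  fixes s t :: complex
  assumes "0 < s" "s \<le> t"
  shows "0 < 1 / t" "1 / t \<le> 1 / s"
proof -
  \<comment> \<open>Comparable complex numbers share their imaginary part, and \<open>0 < s\<close>
    makes it zero, so the claim reduces to positive reals.\<close>
  have "s = of_real (Re s)" "t = of_real (Re t)" and pos: "0 < Re s" "Re s \<le> Re t"
    using assms by (auto simp: less_complex_def less_eq_complex_def complex_eq_iff)
  then obtain a b where "s = of_real a" "t = of_real b" "0 < a" "a \<le> b" by metis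
  moreover have "1 / complex_of_real a = of_real (1 / a)" "1 / complex_of_real b = of_real (1 / b)"
    by simp_all
  ultimately show "0 < 1 / t" "1 / t \<le> 1 / s"
    by (simp_all only: less_complex_def less_eq_complex_def Re_complex_of_real Im_complex_of_real)
      (simp_all add: frac_le)
qed

text \<open>Nonnegativity of the partial products is carried through the induction because
  multiplying inequalities requires it. For infinite \<open>X\<close> both products are 1.\<close>

lemma complex_prod_mono:
  fixes f g :: "'a \<Rightarrow> complex"
  assumes "\<And>i. i \<in> X \<Longrightarrow> 0 \<le> f i \<and> f i \<le> g i"
  shows "0 \<le> prod f X \<and> prod f X \<le> prod g X"
  using assms
proof (induction X rule: infinite_finite_induct)
  case (insert i X)
  then have "0 \<le> f i" "f i \<le> g i" "0 \<le> prod f X" "prod f X \<le> prod g X" by auto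
  then have "0 \<le> f i * prod f X" "f i * prod f X \<le> g i * prod g X"
    by (auto intro: mult_nonneg_nonneg mult_mono)
  then show ?case using insert.hyps by simp
qed (auto simp: less_eq_complex_def)

section \<open>Determinant bounds from sparse inverse approximations\<close>

theorem theorem3p3:
  fixes M :: "complex mat" and n j :: nat
    and I :: "nat \<Rightarrow> nat set" and S :: "nat \<Rightarrow> complex mat" and \<sigma> :: "nat \<Rightarrow> complex"
    and K :: "nat set" and S_hat :: "complex mat" and \<sigma>_hat :: complex
  assumes "M \<in> carrier_mat n n"
    and "hermitian_mat M"
    and "positive_definite_mat M"
    and "\<And>i. i \<in> {1..n} \<Longrightarrow> I i \<subseteq> {..<i} \<and> i - 1 \<in> I i"
    and "\<And>i. i \<in> {1..n} \<Longrightarrow> S i = principal_submatrix (leading_principal_submatrix M i) (I i)"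
    and "\<And>i. i \<in> {1..n} \<Longrightarrow> \<sigma> i = trailing_diag (inverse_mat (S i))"
    and "1 < j" and "j \<le> n"
    and "K \<subseteq> {..<dim_row (S j)}"
    and "j - 1 \<in> pick (I j) ` K"
    and "S_hat = principal_submatrix (S j) K"
    and "\<sigma>_hat = trailing_diag (inverse_mat S_hat)"
  shows "det M \<in> \<real> \<and>
    det M \<le> (\<Prod>i=1..n. 1 / \<sigma> i) \<and>
    (\<Prod>i=1..n. 1 / \<sigma> i) \<le> (1 / \<sigma>_hat) * (\<Prod>i\<in>{1..n} - {j}. 1 / \<sigma> i)"
proof -
  have h: "hpd_mat n M" using assms(1-3) by (simp add: hpd_mat_def)
  let ?L = "leading_principal_submatrix M"
  \<comment> \<open>These are the values for the full choice \<open>I i = {..<i}\<close>, for which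
    the product of reciprocals equals the determinant.\<close>
  define \<tau> where "\<tau> i = trailing_diag (inverse_mat (?L i))" for i
  have I: "I i \<subseteq> {..<i}" "i - 1 \<in> I i" if "i \<in> {1..n}" for i
    using assms(4)[OF that] by auto
  have hL: "hpd_mat i (?L i)" if "i \<in> {1..n}" for i
    using hpd_mat_leading[OF h] that by simp
  have hS: "hpd_mat (card (I i)) (S i)" if "i \<in> {1..n}" for i
    using hpd_mat_principal_submatrix[OF hL[OF that] I(1)[OF that]] assms(5)[OF that] by simp
  have \<sigma>_pos: "0 < \<sigma> i" if "i \<in> {1..n}" for i
    using trailing_diag_inverse[OF hS[OF that] pick_last(2)[OF I[OF that]]] assms(6)[OF that]
    by metis
  have \<sigma>_le: "\<sigma> i \<le> \<tau> i" if "i \<in> {1..n}" for i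
    using trailing_diag_inverse_submatrix_le[OF hL[OF that] I[OF that]]
    by (simp add: \<tau>_def assms(5,6)[OF that])
  have "?L n = M"
    using assms(1) by (subst leading_principal_submatrix_eq) (auto intro!: eq_matI)
  then have det: "det M = (\<Prod>i=1..n. 1 / \<tau> i)"
    using det_leading_eq_prod[OF h order_refl] by (simp add: \<tau>_def)
  have "0 \<le> 1 / \<tau> i \<and> 1 / \<tau> i \<le> 1 / \<sigma> i" if "i \<in> {1..n}" for i
    using complex_inverse_antimono[OF \<sigma>_pos[OF that] \<sigma>_le[OF that]] by (simp add: less_imp_le)
  \<comment> \<open>The lower bound 0 is kept because it also shows that \<open>det M\<close> is
    real.\<close>
  then have det_le: "0 \<le> det M \<and> det M \<le> (\<Prod>i=1..n. 1 / \<sigma> i)"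
    unfolding det by (rule complex_prod_mono)

  have j: "j \<in> {1..n}" using assms(7,8) by simp
  note c = pick_last[OF I[OF j]]
  have dim: "dim_row (S j) = card (I j)" using hS[OF j] by (auto simp: hpd_mat_def)
  have K: "K \<subseteq> {..<card (I j)}" using assms(9) dim by simp
  \<comment> \<open>\<open>K\<close> holds positions within \<open>S j\<close>, while
    \<open>j - 1\<close> is an index of \<open>M\<close>. Injectivity of \<open>pick (I j)\<close>
    on these positions shows that the last position of \<open>S j\<close> belongs to
    \<open>K\<close>.\<close>
  obtain k where k: "k \<in> K" "pick (I j) k = pick (I j) (card (I j) - 1)"
    using assms(10) c(1) by auto
  have "k = card (I j) - 1"
    using k K c(2) card_pick_le[of k "I j"] card_pick_le[of "card (I j) - 1" "I j"] by auto
  then have last: "card (I j) - 1 \<in> K" using k by simp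
  have "0 < \<sigma>_hat"
    using trailing_diag_inverse[OF hpd_mat_principal_submatrix[OF hS[OF j] K] pick_last(2)[OF K last]]
      assms(11,12) by metis
  moreover have "\<sigma>_hat \<le> \<sigma> j"
    using trailing_diag_inverse_submatrix_le[OF hS[OF j] K last]
    by (simp add: assms(11,12) assms(6)[OF j])
  ultimately have hat: "1 / \<sigma> j \<le> 1 / \<sigma>_hat" by (rule complex_inverse_antimono)
  \<comment> \<open>The trivial upper bound lets \<open>complex_prod_mono\<close> be used with equal
    families, only for the nonnegativity of the remaining product.\<close>
  have "0 \<le> (1 / \<sigma> i) \<and> 1 / \<sigma> i \<le> 1 / \<sigma> i" if "i \<in> {1..n} - {j}" for i
    using complex_inverse_antimono(1)[OF \<sigma>_pos order_refl, of i] that by (auto intro: less_imp_le)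
  then have "0 \<le> (\<Prod>i\<in>{1..n} - {j}. 1 / \<sigma> i)" by (rule conjunct1[OF complex_prod_mono])
  then have "(1 / \<sigma> j) * (\<Prod>i\<in>{1..n} - {j}. 1 / \<sigma> i) \<le> (1 / \<sigma>_hat) * (\<Prod>i\<in>{1..n} - {j}. 1 / \<sigma> i)"
    by (rule mult_right_mono[OF hat])
  moreover have "(\<Prod>i=1..n. 1 / \<sigma> i) = (1 / \<sigma> j) * (\<Prod>i\<in>{1..n} - {j}. 1 / \<sigma> i)"
    using j by (intro prod.remove) auto
  ultimately show ?thesis using det_le nonnegative_complex_is_real by simp
qed

end
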